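(* Let $N\ge2$ and let $F$ be any marginal distribution as in the context. Define, for $r\in(0,1]$, $$L(r)=\int_{[0,r]}\frac{x^{\frac N{N-1}}}{r^{\frac1{N-1}}}\,dF(x)+r(1-F(r)),$$ and let $r^*$ be a maximizer of $L$ over $(0,1]$. Then the revenue guarantee of the second price auction with random reserve distributed according to $G_{r^*}(x)=(x/r^* )^{\frac1{N-1}}$, $x\in[0,r^*]$, is strictly greater than the revenue guarantee of the second price auction with the optimal deterministic reserve price (the deterministic reserve price maximizing the revenue guarantee of the second price auction). That is, the former robustly dominates the latter.
   Context: A single indivisible good is sold to $N$ bidders with private values $v_i\in[0,1]$, each with the same marginal cdf $F$ whose support is $[0,1]$ (point masses allowed). $\Pi(F)$ is the set of probability measures on $[0,1]^N$ with all one-dimensional marginals equal to $F$. For a mechanism $(q,t)$ used with truthful bidding, its revenue guarantee is $\inf_{\pi\in\Pi(F)}\int\sum_it_i\,d\pi$. The second price auction with random reserve distributed as a cdf $G$: a reserve $\rho\sim G$ is drawn independently; a highest bidder (ties broken uniformly at random) wins if her bid is at least $\rho$ and pays $\max(\rho,\text{second highest bid})$. The second price auction with deterministic reserve $r$ is the case where $G$ is a point mass at $r$. A mechanism $M_1$ robustly dominates $M_2$ if the revenue guarantee of $M_1$ is strictly greater than that of $M_2$ for every marginal distribution. *)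

theory Defs
  imports "HOL-Probability.Probability"
begin

definition valid_marginal :: "real measure \<Rightarrow> bool" where
  "valid_marginal \<mu> \<longleftrightarrow> prob_space \<mu> \<and> sets \<mu> = sets borel \<and>
     emeasure \<mu> {0..1} = 1 \<and>
     (\<forall>U. open U \<and> U \<inter> {0..1} \<noteq> {} \<longrightarrow> emeasure \<mu> U > 0)"

definition cdf_of :: "real measure \<Rightarrow> real \<Rightarrow> real" where
  "cdf_of \<mu> x = measure \<mu> {..x}"

definition couplings :: "nat \<Rightarrow> real measure \<Rightarrow> (nat \<Rightarrow> real) measure set" where
  "couplings N \<mu> = {\<pi>. prob_space \<pi> \<and> sets \<pi> = sets (PiM {..<N} (\<lambda>_. borel)) \<and>
      (\<forall>i<N. distr \<pi> borel (\<lambda>v. v i) = \<mu>)}"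

text \<open>Revenue guarantee of a mechanism with transfer rule t (t i v = transfer of bidder i
  at truthful profile v).\<close>
definition revenue_guarantee ::
  "nat \<Rightarrow> real measure \<Rightarrow> (nat \<Rightarrow> (nat \<Rightarrow> real) \<Rightarrow> real) \<Rightarrow> real" where
  "revenue_guarantee N \<mu> t = (INF \<pi>\<in>couplings N \<mu>. \<integral>v. (\<Sum>i<N. t i v) \<partial>\<pi>)"

text \<open>Expected transfer of bidder i in the second price auction with random reserve
  \<rho> ~ G (drawn independently): a highest bidder wins (ties broken uniformly at random)
  if her bid is at least \<rho>, and pays max(\<rho>, second highest bid).\<close>
definition spa_transfer :: "nat \<Rightarrow> real measure \<Rightarrow> nat \<Rightarrow> (nat \<Rightarrow> real) \<Rightarrow> real" where
  "spa_transfer N G i v =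
     (\<integral>\<rho>. (if (\<forall>j<N. v j \<le> v i) \<and> \<rho> \<le> v i
            then max \<rho> (Max (v ` ({..<N} - {i}))) / real (card {j\<in>{..<N}. v j = v i})
            else 0) \<partial>G)"

definition spa_rg :: "nat \<Rightarrow> real measure \<Rightarrow> real measure \<Rightarrow> real" where
  "spa_rg N \<mu> G = revenue_guarantee N \<mu> (spa_transfer N G)"

definition det_reserve :: "real \<Rightarrow> real measure" where
  "det_reserve r = return borel r"

definition reserve_dist :: "nat \<Rightarrow> real \<Rightarrow> real measure" where
  "reserve_dist N r = interval_measure
     (\<lambda>x. if x \<le> 0 then 0 else if x \<le> r then (x / r) powr (1 / (real N - 1)) else 1)"

definition L_fun :: "nat \<Rightarrow> real measure \<Rightarrow> real \<Rightarrow> real" where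
  "L_fun N \<mu> r =
     (LINT x:{0..r}|\<mu>. x powr (real N / (real N - 1)) / r powr (1 / (real N - 1)))
     + r * (1 - cdf_of \<mu> r)"

end

theory Submission
  imports Defs
begin

text \<open>
  Let \<open>h\<^sub>r(x) = x^(N/(N-1)) / r^(1/(N-1))\<close> for \<open>x \<le> r\<close> and \<open>h\<^sub>r(x) = r\<close> for \<open>x > r\<close>, so that
  \<open>L(r) = \<integral>h\<^sub>r dF\<close>. With highest value \<open>m\<close> and second highest value \<open>s\<close>, the random reserve earns at
  least \<open>(h\<^sub>r(m) + (N-1) h\<^sub>r(s)) / N\<close>, which dominates the average of the \<open>h\<^sub>r(v\<^sub>i)\<close>; hence it guarantees
  \<open>L(r)\<close>.

  For a deterministic reserve \<open>p\<close>, split the quantiles at \<open>c = F(p-)\<close>. Below \<open>c\<close> all values coincide and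
  nothing is sold. Above \<open>c\<close>, a uniformly chosen leader draws from the top \<open>N\<close>-th part, whose infimum
  is \<open>z\<close>, and all others share one value \<open>x \<in> [p, z]\<close>, so the revenue is \<open>x\<close>. Since the tangent of the
  strictly convex \<open>h\<^sub>z\<close> at \<open>z\<close> is \<open>(N x - z) / (N - 1)\<close>, we get \<open>x \<le> (z + (N-1) h\<^sub>z(x)) / N\<close>, strictly
  for \<open>x < z\<close>. Thus the revenue of this coupling is below \<open>L(z) \<le> L(r*)\<close>; strictness is seen on
  the event \<open>0 < v\<^sub>0 < z\<close>, which has positive probability by full support.
\<close>

subsection \<open>Revenue at a fixed reserve\<close>

text \<open>Fixing the realized reserve before summing over bidders gives the deterministic and the
  random reserve a common pointwise analysis; \<open>sum_spa_transfer\<close> returns to expected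
  transfers.\<close>

definition spa_revenue :: "nat \<Rightarrow> real \<Rightarrow> (nat \<Rightarrow> real) \<Rightarrow> real" where
  "spa_revenue N \<rho> v =
     (\<Sum>i<N. if (\<forall>j<N. v j \<le> v i) \<and> \<rho> \<le> v i
            then max \<rho> (Max (v ` ({..<N} - {i}))) / real (card {j\<in>{..<N}. v j = v i})
            else 0)"

text \<open>All tied highest bidders contribute the same payment divided by the number of ties, so
  uniform tie-breaking cancels in the sum.\<close>

lemma spa_revenue_eq:
  assumes "i < N" and "\<And>j. j < N \<Longrightarrow> v j \<le> v i"
  shows "spa_revenue N \<rho> v = (if \<rho> \<le> v i then max \<rho> (Max (v ` ({..<N} - {i}))) else 0)"
proof -
  define A where "A = {j\<in>{..<N}. v j = v i}"
  have A: "finite A" "i \<in> A" "A \<subseteq> {..<N}"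
    using assms by (auto simp: A_def)
  \<comment> \<open>If two different bidders tie at the top, removing either one keeps their value
    in the image, so both face the same set of rival bids.\<close>
  have img: "v ` ({..<N} - {k}) = v ` ({..<N} - {i})" if "k \<in> A" for k
  proof (cases "k = i")
    case False
    have *: "v ` ({..<N} - {a}) = v ` {..<N}" if "b < N" "v b = v a" "a \<noteq> b" for a b
    proof
      show "v ` {..<N} \<subseteq> v ` ({..<N} - {a})"
      proof
        fix y assume "y \<in> v ` {..<N}"
        then obtain c where "c < N" "y = v c" by auto
        then show "y \<in> v ` ({..<N} - {a})"
          using that by (cases "c = a") (auto intro: image_eqI[of _ v b])
      qed
    qed auto
    show ?thesis
      using *[of i k] *[of k i] that False assms(1) by (auto simp: A_def)
  qed simp
  have "spa_revenue N \<rho> v = (\<Sum>k<N. if k \<in> A then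
      (if \<rho> \<le> v i then max \<rho> (Max (v ` ({..<N} - {i}))) else 0) / real (card A) else 0)"
    unfolding spa_revenue_def
  proof (intro sum.cong refl)
    fix k assume k: "k \<in> {..<N}"
    show "(if (\<forall>j<N. v j \<le> v k) \<and> \<rho> \<le> v k
            then max \<rho> (Max (v ` ({..<N} - {k}))) / real (card {j\<in>{..<N}. v j = v k})
            else 0) = (if k \<in> A then
      (if \<rho> \<le> v i then max \<rho> (Max (v ` ({..<N} - {i}))) else 0) / real (card A) else 0)"
    proof (cases "k \<in> A")
      case True
      then have "v k = v i" by (simp add: A_def)
      then have "{j\<in>{..<N}. v j = v k} = A" by (simp add: A_def)
      then show ?thesis using \<open>v k = v i\<close> True img[OF True] assms(2) by simp
    next
      case False
      then have "v k < v i" using assms(2)[of k] k by (auto simp: A_def)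
      then have "\<not> (\<forall>j<N. v j \<le> v k)" using assms(1) by (auto simp: not_le)
      then show ?thesis by (simp only: if_False simp_thms False)
    qed
  qed
  also have "\<dots> = (\<Sum>k\<in>A. (if \<rho> \<le> v i then max \<rho> (Max (v ` ({..<N} - {i}))) else 0) / real (card A))"
    using A by (simp add: sum.If_cases Int_absorb1)
  also have "\<dots> = (if \<rho> \<le> v i then max \<rho> (Max (v ` ({..<N} - {i}))) else 0)"
    using A by auto
  finally show ?thesis .
qed

lemma measurable_spa_revenue_term:
  fixes N i :: nat
  assumes "i < N"
  shows "(\<lambda>(v, \<rho>). if (\<forall>j<N. v j \<le> v i) \<and> \<rho> \<le> v i
            then max \<rho> (Max (v ` ({..<N} - {i}))) / real (card {j\<in>{..<N}. v j = v i})
            else 0) \<in> borel_measurable (PiM {..<N} (\<lambda>_. borel :: real measure) \<Otimes>\<^sub>M borel)"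
proof -
  let ?P = "PiM {..<N} (\<lambda>_. borel :: real measure) \<Otimes>\<^sub>M (borel :: real measure)"
  have 1 [measurable]: "(\<lambda>x. fst x j) \<in> borel_measurable ?P" if "j \<in> {..<N}" for j
    using that by measurable
  \<comment> \<open>As a finite sum of comparisons the tie count is visibly measurable.\<close>
  have card: "real (card {j\<in>{..<N}. v j = v i}) = (\<Sum>j<N. if v j = v i then 1 else 0)" for v :: "nat \<Rightarrow> real"
    by (simp add: sum.If_cases Int_def)
  have all: "(\<forall>j<N. v j \<le> v i) \<longleftrightarrow> (\<forall>j\<in>{..<N}. v j \<le> v i)" for v :: "nat \<Rightarrow> real"
    by auto
  show ?thesis
    unfolding card all case_prod_beta using assms
    by (intro measurable_If borel_measurable_divide borel_measurable_max borel_measurable_Max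
        borel_measurable_sum 1 measurable_snd measurable_const sets.sets_Collect
        sets.sets_Collect_finite_All borel_measurable_le) auto
qed

lemma measurable_spa_revenue:
  "(\<lambda>(v, \<rho>). spa_revenue N \<rho> v) \<in> borel_measurable (PiM {..<N} (\<lambda>_. borel :: real measure) \<Otimes>\<^sub>M borel)"
  unfolding spa_revenue_def case_prod_beta
  by (intro borel_measurable_sum measurable_spa_revenue_term[unfolded case_prod_beta]) simp

text \<open>Reduces a profile to its highest value \<open>v i\<close> and second highest value
  \<open>s\<close>, so that the bounds derived from it mention neither \<open>Max\<close> nor ties.
  Under a tie, \<open>s = v i\<close>.\<close>

lemma spa_maximizer:
  assumes "2 \<le> N" and "\<And>i. i < N \<Longrightarrow> 0 \<le> (v i :: real)"
  shows "\<exists>i<N. \<exists>s. (\<forall>j<N. v j \<le> v i) \<and> 0 \<le> s \<and> s \<le> v i \<and> (\<forall>j<N. j \<noteq> i \<longrightarrow> v j \<le> s) \<and>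
    (\<forall>\<rho>. spa_revenue N \<rho> v = (if \<rho> \<le> v i then max \<rho> s else 0))"
proof -
  have "Max (v ` {..<N}) \<in> v ` {..<N}"
    using assms(1) by (intro Max_in) (auto simp: lessThan_empty_iff)
  then obtain i where i: "i < N" "Max (v ` {..<N}) = v i" by auto
  have le: "v j \<le> v i" if "j < N" for j
    using that by (subst i(2)[symmetric]) (intro Max_ge, auto)
  define s where "s = Max (v ` ({..<N} - {i}))"
  have "(if i = 0 then 1 else 0) \<in> {..<N} - {i}" using assms(1) by auto
  then have "v ` ({..<N} - {i}) \<noteq> {}" by blast
  then have "s \<in> v ` ({..<N} - {i})" unfolding s_def by (intro Max_in) auto
  then obtain j where "j < N" "s = v j" by auto
  then have "0 \<le> s" "s \<le> v i" using assms(2) le by auto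
  moreover have "v j \<le> s" if "j < N" "j \<noteq> i" for j
    using that unfolding s_def by (intro Max_ge) auto
  moreover have "spa_revenue N \<rho> v = (if \<rho> \<le> v i then max \<rho> s else 0)" for \<rho>
    using spa_revenue_eq[of i N v \<rho>] i(1) le unfolding s_def by simp
  ultimately show ?thesis
    using i(1) le by blast
qed

lemma spa_revenue_bounds:
  assumes "2 \<le> N" and "\<And>i. i < N \<Longrightarrow> 0 \<le> v i" "\<And>i. i < N \<Longrightarrow> v i \<le> B"
  shows "0 \<le> spa_revenue N \<rho> v" "spa_revenue N \<rho> v \<le> B"
proof -
  obtain i s where "i < N" "0 \<le> s" "s \<le> v i"
    "\<forall>\<rho>. spa_revenue N \<rho> v = (if \<rho> \<le> v i then max \<rho> s else 0)"
    using spa_maximizer[of N v, OF assms(1,2)] by blast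
  then show "0 \<le> spa_revenue N \<rho> v" "spa_revenue N \<rho> v \<le> B"
    using assms(2,3)[of i] by auto
qed

lemma sum_spa_transfer:
  assumes "prob_space G" and sets: "sets G = sets borel"
  shows "(\<Sum>i<N. spa_transfer N G i v) = (\<integral>\<rho>. spa_revenue N \<rho> v \<partial>G)"
  unfolding spa_transfer_def spa_revenue_def
proof (intro Bochner_Integration.integral_sum[symmetric])
  interpret prob_space G by fact
  note sets [measurable_cong]
  fix i
  let ?M = "Max (v ` ({..<N} - {i}))" and ?n = "card {j\<in>{..<N}. v j = v i}"
  show "integrable G (\<lambda>\<rho>. if (\<forall>j<N. v j \<le> v i) \<and> \<rho> \<le> v i then max \<rho> ?M / real ?n else 0)"
  \<comment> \<open>When the reserve is at most \<open>v i\<close>, the payment lies between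
    \<open>?M\<close> and the larger of \<open>v i\<close> and \<open>?M\<close>, however negative
    the reserve. The case of a zero count in \<open>quot\<close> rests on division by zero giving
    0.\<close>
  proof (rule integrable_const_bound[where B="\<bar>v i\<bar> + \<bar>?M\<bar>"])
    have quot: "\<bar>x / real n\<bar> \<le> \<bar>x\<bar>" for x and n :: nat
    proof (cases "n = 0")
      case False
      then have "\<bar>x\<bar> / real n \<le> \<bar>x\<bar> / 1" by (intro divide_left_mono) auto
      then show ?thesis by simp
    qed simp
    have "\<bar>max \<rho> ?M / real ?n\<bar> \<le> \<bar>v i\<bar> + \<bar>?M\<bar>" if "\<rho> \<le> v i" for \<rho>
      using quot[of "max \<rho> ?M" ?n] that by linarith
    then show "AE \<rho> in G. norm (if (\<forall>j<N. v j \<le> v i) \<and> \<rho> \<le> v i then max \<rho> ?M / real ?n else 0)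
        \<le> \<bar>v i\<bar> + \<bar>?M\<bar>"
      by (intro AE_I2) auto
  next
    show "(\<lambda>\<rho>. if (\<forall>j<N. v j \<le> v i) \<and> \<rho> \<le> v i then max \<rho> ?M / real ?n else 0)
        \<in> borel_measurable G"
      by (cases "\<forall>j<N. v j \<le> v i") (simp_all only: simp_thms if_False, measurable)
  qed
qed

subsection \<open>The integrand of \<open>L\<close>\<close>

text \<open>This is h_r of the overview: the exponent N/(N-1) is a root of order N-1 followed by the
  power N, and since 1 - N/(N-1) = -1/(N-1), the factor r leaves a division by r^(1/(N-1)). Clipping
  x/r to [0,1] makes the function bounded and monotone on the whole line.\<close>

definition capped :: "nat \<Rightarrow> real \<Rightarrow> real \<Rightarrow> real" where
  "capped N r x = r * root (N - 1) (min 1 (max 0 x / r)) ^ N"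

text \<open>The polynomial has a double zero at y = 1: it starts as (1-y)^2, and passing from k to
  k+1 adds (k+1) y^k (1-y)^2.\<close>

lemma tangent_power_ineq:
  fixes y :: real
  assumes "0 < k" "0 \<le> y" "y < 1"
  shows "0 < 1 + real k * y ^ Suc k - real (Suc k) * y ^ k"
  using assms(1)
proof (induction k rule: nat_induct_non_zero)
  case 1
  have "(1 - y)^2 > 0" using assms by simp
  then show ?case by (simp add: power2_eq_square algebra_simps)
next
  case (Suc k)
  have "1 + real (Suc k) * y ^ Suc (Suc k) - real (Suc (Suc k)) * y ^ Suc k
    = (1 + real k * y ^ Suc k - real (Suc k) * y ^ k) + real (Suc k) * y ^ k * (1 - y)^2"
    by (simp add: power2_eq_square algebra_simps)
  moreover have "0 \<le> real (Suc k) * y ^ k * (1 - y)^2"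
    using assms by simp
  ultimately show ?case using Suc.IH by linarith
qed

lemma capped_bounds:
  assumes "2 \<le> N" "0 < r"
  shows "0 \<le> capped N r x" "capped N r x \<le> r"
proof -
  have "0 \<le> root (N - 1) (min 1 (max 0 x / r))" "root (N - 1) (min 1 (max 0 x / r)) \<le> 1"
    using assms by auto
  then show "0 \<le> capped N r x" "capped N r x \<le> r"
    using assms by (auto simp: capped_def mult_left_le power_le_one)
qed

lemma capped_pos:
  assumes "2 \<le> N" "0 < r" "0 < x"
  shows "0 < capped N r x"
  using assms by (auto simp: capped_def)

lemma capped_mono:
  assumes "2 \<le> N" "0 < r" "x \<le> y"
  shows "capped N r x \<le> capped N r y"
proof -
  have "max 0 x / r \<le> max 0 y / r"
    using assms by (intro divide_right_mono) auto
  then show ?thesis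
    using assms unfolding capped_def
    by (intro mult_left_mono power_mono) auto
qed

lemma capped_above:
  assumes "2 \<le> N" "0 < r" "r \<le> x"
  shows "capped N r x = r"
  using assms by (simp add: capped_def min_absorb1 max_absorb2)

text \<open>The tangent line of the convex function \<open>capped N z\<close> at \<open>z\<close> is \<open>(N x - z) / (N - 1)\<close>.\<close>
lemma capped_tangent:
  assumes "2 \<le> N" "0 < z" "0 \<le> x" "x < z"
  shows "real N * x < z + (real N - 1) * capped N z x"
proof -
  define k where "k = N - 1"
  \<comment> \<open>With this substitution x = z y^k and the capped value is z y^(k+1), which turns
    the tangent inequality into a polynomial one.\<close>
  define y where "y = root k (x / z)"
  have k: "0 < k" "N = Suc k" using assms by (auto simp: k_def)
  have y: "0 \<le> y" "y < 1" "y ^ k = x / z"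
    using assms k by (auto simp: y_def)
  have "x / z \<le> 1" using assms by simp
  then have "capped N z x = z * y ^ Suc k"
    using assms k by (simp add: capped_def y_def)
  moreover have "x = z * y ^ k" using y(3) assms by simp
  ultimately have "z + (real N - 1) * capped N z x - real N * x
      = z * (1 + real k * y ^ Suc k - real (Suc k) * y ^ k)"
    using k(2) by (simp add: algebra_simps)
  also have "\<dots> > 0"
    using tangent_power_ineq[OF k(1) y(1,2)] assms by (intro mult_pos_pos) auto
  finally show ?thesis by simp
qed

lemma measurable_capped [measurable]:
  assumes "2 \<le> N"
  shows "capped N r \<in> borel_measurable borel"
proof -
  have [measurable]: "root (N - 1) \<in> borel_measurable borel"
    by (intro borel_measurable_continuous_onI continuous_intros)
  show ?thesis unfolding capped_def[abs_def] by measurable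
qed

text \<open>The two summands of \<open>L_fun\<close> are the contributions of values up to r and
  above r to one integral. The pointwise identity is checked for nonnegative x, hence almost
  everywhere.\<close>

lemma L_fun_eq:
  assumes "2 \<le> N" "valid_marginal \<mu>" "0 < r"
  shows "L_fun N \<mu> r = (\<integral>x. capped N r x \<partial>\<mu>)"
proof -
  interpret prob_space \<mu> using assms by (simp add: valid_marginal_def)
  have sets [measurable_cong]: "sets \<mu> = sets borel" using assms by (simp add: valid_marginal_def)
  have sp [simp]: "space \<mu> = UNIV" using sets_eq_imp_space_eq[OF sets] by simp
  have "AE x in \<mu>. x \<in> {0..1}"
    using assms prob_eq_1[of "{0..1}"] by (auto simp: valid_marginal_def measure_def sets)
  moreover have "capped N r x = indicator {0..r} x *\<^sub>R (x powr (real N / (real N - 1)) / r powr (1 / (real N - 1)))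
      + r * indicator {r<..} x" if "0 \<le> x" for x
  proof (cases "x \<le> r")
    case True
    define k where "k = N - 1"
    have k: "0 < k" "N = Suc k" "real N - 1 = real k" using assms by (auto simp: k_def)
    have "root k (x / r) ^ N * r = x powr (real N / real k) / r powr (1 / real k)"
    proof (cases "x = 0")
      case False
      then have x: "0 < x" using that by simp
      have "root k (x / r) ^ N = (x / r) powr (real N / real k)"
        using x assms k by (simp add: root_powr_inverse powr_powr powr_realpow[symmetric] field_simps
          del: of_nat_Suc power_Suc)
      also have "\<dots> = x powr (real N / real k) / r powr (1 / real k) / r"
      proof -
        \<comment> \<open>Splitting the exponent isolates one factor r, which cancels against the
          prefactor in \<open>capped\<close>.\<close>
        have "real N / real k = 1 + 1 / real k" using k by (simp add: field_simps)
        then have "r powr (real N / real k) = r * r powr (1 / real k)"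
          using assms powr_add[of r 1 "1 / real k"] by simp
        then show ?thesis using x assms by (simp add: powr_divide)
      qed
      finally show ?thesis using assms by simp
    qed (use k in auto)
    moreover have "capped N r x = r * root k (x / r) ^ N"
      using True that assms by (simp add: capped_def k_def)
    ultimately show ?thesis using True that by (simp add: k(3) mult.commute)
  next
    case False
    then show ?thesis using assms by (simp add: capped_above)
  qed
  ultimately have "(\<integral>x. capped N r x \<partial>\<mu>) = (\<integral>x. indicator {0..r} x *\<^sub>R (x powr (real N / (real N - 1)) / r powr (1 / (real N - 1)))
      + r * indicator {r<..} x \<partial>\<mu>)"
    using assms by (intro integral_cong_AE) auto
  also have "\<dots> = (\<integral>x. indicator {0..r} x *\<^sub>R (x powr (real N / (real N - 1)) / r powr (1 / (real N - 1))) \<partial>\<mu>)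
      + (\<integral>x. r * indicator {r<..} x \<partial>\<mu>)"
  proof (intro Bochner_Integration.integral_add)
    show "integrable \<mu> (\<lambda>x. indicator {0..r} x *\<^sub>R (x powr (real N / (real N - 1)) / r powr (1 / (real N - 1))))"
    proof (rule integrable_const_bound[where B="r powr (real N / (real N - 1)) / r powr (1 / (real N - 1))"])
      show "AE x in \<mu>. norm (indicator {0..r} x *\<^sub>R (x powr (real N / (real N - 1)) / r powr (1 / (real N - 1))))
         \<le> r powr (real N / (real N - 1)) / r powr (1 / (real N - 1))"
        using assms by (intro AE_I2) (auto simp: indicator_def intro!: divide_right_mono powr_mono2)
    qed measurable
  qed (auto simp: integrable_indicator_iff emeasure_eq_measure sets)
  also have "(\<integral>x. r * indicator {r<..} x \<partial>\<mu>) = r * (1 - cdf_of \<mu> r)"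
  proof -
    have "UNIV - {..r} = {r<..}" by auto
    then show ?thesis using prob_compl[of "{..r}"] by (simp add: cdf_of_def sets)
  qed
  finally show ?thesis by (simp add: L_fun_def set_lebesgue_integral_def)
qed

subsection \<open>Couplings\<close>

text \<open>Couplings arise as joint laws of random variables on an auxiliary probability space. The
  restriction to \<open>{..<N}\<close> places profiles in the extensional function space underlying
  \<open>PiM\<close>.\<close>

lemma couplingsI:
  assumes "prob_space M" "0 < N"
    and X: "\<And>i. i < N \<Longrightarrow> X i \<in> borel_measurable M"
    and distr: "\<And>i. i < N \<Longrightarrow> distr M borel (X i) = \<mu>"
  shows "distr M (PiM {..<N} (\<lambda>_. borel)) (\<lambda>\<omega>. \<lambda>i\<in>{..<N}. X i \<omega>) \<in> couplings N \<mu>"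
proof -
  have m: "(\<lambda>\<omega>. \<lambda>i\<in>{..<N}. X i \<omega>) \<in> M \<rightarrow>\<^sub>M PiM {..<N} (\<lambda>_. borel)"
    using X by (intro measurable_restrict) auto
  have "distr (distr M (PiM {..<N} (\<lambda>_. borel)) (\<lambda>\<omega>. \<lambda>i\<in>{..<N}. X i \<omega>)) borel (\<lambda>v. v i) = \<mu>"
    if "i < N" for i
  proof -
    have "(\<lambda>v. v i) \<in> PiM {..<N} (\<lambda>_. borel :: real measure) \<rightarrow>\<^sub>M borel" using that by simp
    then show ?thesis using that distr[OF that] by (simp add: distr_distr m comp_def)
  qed
  then show ?thesis
    using assms(1) m by (auto simp: couplings_def intro!: prob_space.prob_space_distr)
qed

lemma couplings_component:
  assumes "\<pi> \<in> couplings N \<mu>" "i < N"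
  shows "(\<lambda>v. v i) \<in> borel_measurable \<pi>"
proof -
  have "sets \<pi> = sets (PiM {..<N} (\<lambda>_. borel))" using assms by (simp add: couplings_def)
  moreover have "(\<lambda>v. v i) \<in> borel_measurable (PiM {..<N} (\<lambda>_. borel :: real measure))"
    using assms by simp
  ultimately show ?thesis by (simp cong: measurable_cong_sets)
qed

lemma couplings_AE:
  assumes "valid_marginal \<mu>" "\<pi> \<in> couplings N \<mu>"
  shows "AE v in \<pi>. \<forall>i<N. 0 \<le> v i \<and> v i \<le> 1"
proof -
  interpret \<mu>: prob_space \<mu> using assms by (simp add: valid_marginal_def)
  have sets: "sets \<mu> = sets borel" using assms by (simp add: valid_marginal_def)
  have ae: "AE x in \<mu>. x \<in> {0..1}"
    using assms \<mu>.prob_eq_1[of "{0..1}"] by (auto simp: valid_marginal_def measure_def sets)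
  have "AE v in \<pi>. v i \<in> {0..1}" if "i < N" for i
  proof (rule AE_distrD[where f="\<lambda>v. v i" and M'=borel and P="\<lambda>x. x \<in> {0..1}"])
    show "(\<lambda>v. v i) \<in> borel_measurable \<pi>" using couplings_component[OF assms(2) that] .
    show "AE x in distr \<pi> borel (\<lambda>v. v i). x \<in> {0..1}"
    proof -
      have eq: "distr \<pi> borel (\<lambda>v. v i) = \<mu>" using that assms(2) by (simp add: couplings_def)
      show ?thesis unfolding eq by (rule ae)
    qed
  qed
  then have "AE v in \<pi>. \<forall>i\<in>{..<N}. v i \<in> {0..1}"
    by (intro AE_finite_allI) auto
  then show ?thesis by eventually_elim auto
qed

lemma couplings_integral:
  assumes "\<pi> \<in> couplings N \<mu>" "i < N" and [measurable]: "f \<in> borel_measurable borel"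
  shows "(\<integral>v. f (v i) \<partial>\<pi>) = (\<integral>x. f x \<partial>\<mu> :: real)"
proof -
  have "(\<lambda>v. v i) \<in> borel_measurable \<pi>" using couplings_component[OF assms(1,2)] .
  moreover have "\<mu> = distr \<pi> borel (\<lambda>v. v i)" using assms by (simp add: couplings_def)
  ultimately show ?thesis by (simp add: integral_distr)
qed

text \<open>Values lie in [0,1] almost surely, so revenue does too. Integrability justifies
  comparing integrals, and nonnegativity bounds the infimum in \<open>revenue_guarantee\<close> from
  below.\<close>

lemma integrable_revenue:
  assumes "2 \<le> N" "valid_marginal \<mu>" "\<pi> \<in> couplings N \<mu>" "prob_space G" and sG: "sets G = sets borel"
  shows "integrable \<pi> (\<lambda>v. \<Sum>i<N. spa_transfer N G i v)"
    "AE v in \<pi>. 0 \<le> (\<Sum>i<N. spa_transfer N G i v)"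
proof -
  interpret G: prob_space G by fact
  interpret \<pi>: prob_space \<pi> using assms by (simp add: couplings_def)
  have sets: "sets \<pi> = sets (PiM {..<N} (\<lambda>_. borel))"
    using assms by (simp add: couplings_def)
  have "sets (\<pi> \<Otimes>\<^sub>M G) = sets (PiM {..<N} (\<lambda>_. borel :: real measure) \<Otimes>\<^sub>M borel)"
    using sets sG by (rule sets_pair_measure_cong)
  then have m: "(\<lambda>(v, \<rho>). spa_revenue N \<rho> v) \<in> borel_measurable (\<pi> \<Otimes>\<^sub>M G)"
    using measurable_spa_revenue[of N] by (simp cong: measurable_cong_sets)
  then have m1: "(\<lambda>v. \<integral>\<rho>. spa_revenue N \<rho> v \<partial>G) \<in> borel_measurable \<pi>"
    by (rule G.borel_measurable_lebesgue_integral)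
  have bd: "AE v in \<pi>. 0 \<le> (\<integral>\<rho>. spa_revenue N \<rho> v \<partial>G) \<and> (\<integral>\<rho>. spa_revenue N \<rho> v \<partial>G) \<le> 1"
    using couplings_AE[OF assms(2,3)] AE_space
  proof eventually_elim
    case (elim v)
    have b: "0 \<le> spa_revenue N \<rho> v" "spa_revenue N \<rho> v \<le> 1" for \<rho>
      using spa_revenue_bounds[OF assms(1), of v 1] elim by auto
    have "integrable G (\<lambda>\<rho>. spa_revenue N \<rho> v)"
    proof (rule G.integrable_const_bound[where B=1])
      show "(\<lambda>\<rho>. spa_revenue N \<rho> v) \<in> borel_measurable G"
        using measurable_Pair2[OF m elim(2)] by simp
    qed (use b in auto)
    then show ?case
      using b by (auto intro!: G.integral_le_const integral_nonneg)
  qed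
  show "integrable \<pi> (\<lambda>v. \<Sum>i<N. spa_transfer N G i v)"
    unfolding sum_spa_transfer[OF assms(4) sG]
    by (rule \<pi>.integrable_const_bound[where B=1]) (use bd m1 in auto)
  show "AE v in \<pi>. 0 \<le> (\<Sum>i<N. spa_transfer N G i v)"
    unfolding sum_spa_transfer[OF assms(4) sG] using bd by eventually_elim auto
qed

subsection \<open>The random reserve\<close>

text \<open>The open interval is chosen because the pseudoinverse of a cdf is controlled only at
  quantiles strictly between 0 and 1.\<close>

abbreviation unit_uniform :: "real measure" where
  "unit_uniform \<equiv> restrict_space lborel {0<..<1}"

lemma prob_space_unit_uniform: "prob_space unit_uniform"
  by (auto simp: space_restrict_space emeasure_restrict_space intro!: prob_spaceI)

text \<open>Inverse transform sampling: the inverse of u = (x/r)^(1/(N-1)) is x = r u^(N-1).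
  Integrals over the reserve thereby become integrals of powers of u.\<close>

lemma reserve_dist_eq:
  assumes "2 \<le> N" "0 < r"
  shows "reserve_dist N r = distr unit_uniform borel (\<lambda>u. r * u ^ (N - 1))"
proof -
  define k where "k = N - 1"
  have k: "0 < k" "real N - 1 = real k" using assms by (auto simp: k_def)
  let ?D = "distr unit_uniform borel (\<lambda>u. r * u ^ k)"
  have [measurable]: "(\<lambda>u. r * u ^ k) \<in> borel_measurable unit_uniform"
    by (intro measurable_restrict_space1) simp
  interpret real_distribution ?D
    using prob_space_unit_uniform by (intro prob_space.real_distribution_distr) auto
  have "cdf ?D x = (if x \<le> 0 then 0 else if x \<le> r then (x / r) powr (1 / (real N - 1)) else 1)" for x
  proof -
    have eq: "cdf ?D x = measure lborel {u\<in>{0<..<1}. r * u ^ k \<le> x}"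
      by (auto simp: cdf_def measure_distr measure_restrict_space space_restrict_space
          intro!: arg_cong2[where f=measure])
    consider "x \<le> 0" | "0 < x" "x < r" | "r \<le> x" by linarith
    then show ?thesis
    proof cases
      case 1
      have "{u\<in>{0<..<1}. r * u ^ k \<le> x} = {}"
      proof (safe, goal_cases)
        case (1 u)
        then have "0 < r * u ^ k" using assms by simp
        then show ?case using 1 \<open>x \<le> 0\<close> by simp
      qed
      then show ?thesis using 1 unfolding eq \<open>_ = {}\<close> by simp
    next
      case 2
      define b where "b = root k (x / r)"
      have b: "0 < b" "b < 1" "r * b ^ k = x" using 2 k by (auto simp: b_def)
      have "{u\<in>{0<..<1}. r * u ^ k \<le> x} = {0<..b}"
        using b k assms 2 by (auto simp: b(3)[symmetric] power_mono_iff)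
      then show ?thesis using 2 b k unfolding eq by (simp add: b_def root_powr_inverse)
    next
      case 3
      have "{u\<in>{0<..<1}. r * u ^ k \<le> x} = {0<..<1}"
      proof (safe, goal_cases)
        case (1 u)
        then have "r * u ^ k \<le> r * 1" using assms by (intro mult_left_mono power_le_one) auto
        then show ?case using 3 by simp
      qed
      then show ?thesis using 3 assms unfolding eq by auto
    qed
  qed
  then have "reserve_dist N r = interval_measure (cdf ?D)"
    unfolding reserve_dist_def by presburger
  also have "\<dots> = ?D"
    by (intro cdf_unique real_distribution_interval_measure cdf_interval_measure)
      (auto intro: cdf_nondecreasing cdf_is_right_cont cdf_lim_at_top_prob cdf_lim_at_bot
        real_distribution_axioms)
  finally show ?thesis by (simp add: k_def)
qed

text \<open>On the scale of u, the reserve r u^k reaches s at b and m at a, both capped at 1. Below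
  b the price is at least r b^k; between b and a it is at least r u^k. Integrating gives the left
  side, which is the average of one capped value at m and k capped values at s.\<close>

lemma integral_spa_revenue_ge:
  fixes k :: nat
  assumes "0 < k" "0 < r" "0 \<le> s" "s \<le> m"
  defines "a \<equiv> root k (min 1 (m / r))" and "b \<equiv> root k (min 1 (s / r))"
  shows "r * b ^ Suc k + r * (a ^ Suc k - b ^ Suc k) / real (Suc k)
    \<le> (\<integral>u. (if r * u ^ k \<le> m then max (r * u ^ k) s else 0) \<partial>unit_uniform)"
proof -
  interpret U: prob_space unit_uniform by (rule prob_space_unit_uniform)
  let ?g = "\<lambda>u. if r * u ^ k \<le> m then max (r * u ^ k) s else 0"
  \<comment> \<open>The step-plus-power minorant of revenue; its integral is exactly the claimed
    bound.\<close>
  let ?\<phi> = "\<lambda>u. r * b ^ k * indicator {0..<b} u + r * (u ^ k * indicator {b..a} u)"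
  have ab: "0 \<le> b" "b \<le> a" "a \<le> 1"
  proof -
    have "s / r \<le> m / r" using assms(2,4) by (simp add: divide_right_mono)
    then show "0 \<le> b" "b \<le> a" "a \<le> 1"
      using assms(1-3) by (simp_all add: a_def b_def min.coboundedI2)
  qed
  have min: "r * min 1 (x / r) \<le> x" for x
    using assms(2) by (simp add: min_def pos_le_divide_eq mult.commute)
  have "a ^ k = min 1 (m / r)" "b ^ k = min 1 (s / r)"
    using assms(1-4) by (simp_all add: a_def b_def)
  then have ak: "r * a ^ k \<le> m" and bk: "r * b ^ k \<le> s"
    using min by simp_all
  have int: "integrable lborel (\<lambda>u. u ^ k * indicator {b..a} u)"
    using borel_integrable_atLeastAtMost'[of b a "\<lambda>u. u ^ k"]
    by (simp add: set_integrable_def mult.commute continuous_intros)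
  have int2: "integrable lborel (\<lambda>u. r * b ^ k * indicator {0..<b} u)"
    using ab by (intro integrable_real_mult_indicator integrable_mult_right) auto
  have "r * b ^ Suc k + r * (a ^ Suc k - b ^ Suc k) / real (Suc k) = (\<integral>u. ?\<phi> u \<partial>lborel)"
    using int int2 ab(1) integral_power[OF ab(2), of k]
    by (simp del: of_nat_Suc)
  also have "\<dots> \<le> (\<integral>u. indicator {0<..<1} u *\<^sub>R ?g u \<partial>lborel)"
  proof (rule integral_mono_AE)
    show "integrable lborel ?\<phi>" using int int2 by auto
    have "integrable unit_uniform ?g"
    proof (rule U.integrable_const_bound[where B=m])
      show "?g \<in> borel_measurable unit_uniform"
        by (intro measurable_restrict_space1) measurable
    qed (use assms in auto)
    then show "integrable lborel (\<lambda>u. indicator {0<..<1} u *\<^sub>R ?g u)"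
      by (subst (asm) integrable_restrict_space) auto
    have "AE u in lborel. u \<noteq> (0::real)" "AE u in lborel. u \<noteq> (1::real)"
      by (rule AE_lborel_singleton)+
    then show "AE u in lborel. ?\<phi> u \<le> indicator {0<..<1} u *\<^sub>R ?g u"
    proof eventually_elim
      case (elim u)
      consider "u < 0 \<or> 1 < u" | "0 < u" "u < b" | "0 < u" "b \<le> u" "u \<le> a" "u < 1" | "0 < u" "a < u" "u < 1"
        using elim ab by linarith
      then show ?case
      proof cases
        case 2
        then have "r * u ^ k \<le> r * b ^ k" using assms(2) by (intro mult_left_mono power_mono) auto
        then have "r * u ^ k \<le> m" "r * b ^ k \<le> max (r * u ^ k) s" using bk assms(4) by auto
        then show ?thesis using 2 ab by simp
      next
        case 3
        then have "r * u ^ k \<le> r * a ^ k" using assms(2) by (intro mult_left_mono power_mono) auto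
        then have "r * u ^ k \<le> m" using ak by auto
        then show ?thesis using 3 ab by simp
      qed (use ab assms(3) in \<open>auto simp: indicator_def\<close>)
    qed
  qed
  also have "\<dots> = (\<integral>u. ?g u \<partial>unit_uniform)"
    by (subst integral_restrict_space) auto
  finally show ?thesis .
qed

text \<open>By monotonicity each bidder other than the leader contributes at most the capped second
  highest value. The lower bound is a sum of functions of single values, so its expectation is the
  same under every coupling.\<close>

lemma spa_revenue_random_ge:
  assumes "2 \<le> N" "0 < r" and "\<And>i. i < N \<Longrightarrow> 0 \<le> v i"
  shows "(\<Sum>i<N. capped N r (v i)) / real N \<le> (\<integral>\<rho>. spa_revenue N \<rho> v \<partial>reserve_dist N r)"
proof -
  obtain i s where i: "i < N" "0 \<le> s" "s \<le> v i" "\<forall>j<N. j \<noteq> i \<longrightarrow> v j \<le> s"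
    and rev: "\<forall>\<rho>. spa_revenue N \<rho> v = (if \<rho> \<le> v i then max \<rho> s else 0)"
    using spa_maximizer[of N v, OF assms(1,3)] by blast
  define k where "k = N - 1"
  have k: "0 < k" "N = Suc k" using assms by (auto simp: k_def)
  have "(\<Sum>j<N. capped N r (v j)) = capped N r (v i) + (\<Sum>j\<in>{..<N} - {i}. capped N r (v j))"
    using i(1) by (simp add: sum.remove)
  also have "(\<Sum>j\<in>{..<N} - {i}. capped N r (v j)) \<le> (\<Sum>j\<in>{..<N} - {i}. capped N r s)"
    using assms i(4) by (intro sum_mono capped_mono) auto
  also have "\<dots> = real k * capped N r s"
    using i(1) by (simp add: k_def)
  finally have "(\<Sum>j<N. capped N r (v j)) / real N \<le> (capped N r (v i) + real k * capped N r s) / real N"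
    by (simp add: divide_right_mono)
  also have "\<dots> = r * root k (min 1 (s / r)) ^ Suc k
      + r * (root k (min 1 (v i / r)) ^ Suc k - root k (min 1 (s / r)) ^ Suc k) / real (Suc k)"
  proof -
    have "(r * A + real k * (r * B)) / real (Suc k) = r * B + r * (A - B) / real (Suc k)" for A B
      by (simp add: field_simps)
    then show ?thesis
      using i(2,3) k by (simp add: capped_def max_absorb2 del: power_Suc of_nat_Suc)
  qed
  also have "\<dots> \<le> (\<integral>u. spa_revenue N (r * u ^ k) v \<partial>unit_uniform)"
    unfolding rev[rule_format] using k assms i by (intro integral_spa_revenue_ge) auto
  also have "\<dots> = (\<integral>\<rho>. spa_revenue N \<rho> v \<partial>reserve_dist N r)"
    unfolding reserve_dist_eq[OF assms(1,2)] rev[rule_format] k_def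
    by (subst integral_distr) (auto intro!: measurable_restrict_space1)
  finally show ?thesis .
qed

lemma prob_space_reserve_dist:
  assumes "2 \<le> N" "0 < r"
  shows "prob_space (reserve_dist N r)" "sets (reserve_dist N r) = sets borel"
  unfolding reserve_dist_eq[OF assms]
  by (auto intro!: prob_space.prob_space_distr prob_space_unit_uniform measurable_restrict_space1)

lemma spa_rg_random_ge:
  assumes "2 \<le> N" "valid_marginal \<mu>" "0 < r"
  shows "L_fun N \<mu> r \<le> spa_rg N \<mu> (reserve_dist N r)"
  unfolding spa_rg_def revenue_guarantee_def
proof (rule cINF_greatest)
  have "prob_space \<mu>" "sets \<mu> = sets borel" using assms by (auto simp: valid_marginal_def)
  \<comment> \<open>The infimum is taken over a nonempty set: all bidders may share one value drawn
    from the marginal.\<close>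
  then show "couplings N \<mu> \<noteq> {}"
    using couplingsI[of \<mu> N "\<lambda>_ x. x" \<mu>] assms(1)
    by (auto simp: distr_id2 cong: measurable_cong_sets)
  fix \<pi> assume \<pi>: "\<pi> \<in> couplings N \<mu>"
  interpret \<pi>: prob_space \<pi> using \<pi> by (simp add: couplings_def)
  note [measurable] = measurable_capped[OF assms(1), of r]
  have int: "integrable \<pi> (\<lambda>v. capped N r (v i))" if "i < N" for i
  proof (rule \<pi>.integrable_const_bound[where B=r])
    show "(\<lambda>v. capped N r (v i)) \<in> borel_measurable \<pi>" 
      using couplings_component[OF \<pi> that] by measurable
  qed (use capped_bounds[OF assms(1,3)] in auto)
  have "L_fun N \<mu> r = (\<Sum>i<N. \<integral>v. capped N r (v i) \<partial>\<pi>) / real N"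
    using L_fun_eq[OF assms] couplings_integral[OF \<pi>, of _ "capped N r"] assms(1) by simp
  also have "\<dots> = (\<integral>v. (\<Sum>i<N. capped N r (v i)) / real N \<partial>\<pi>)"
    using int by simp
  also have "\<dots> \<le> (\<integral>v. (\<Sum>i<N. spa_transfer N (reserve_dist N r) i v) \<partial>\<pi>)"
  proof (rule integral_mono_AE)
    show "integrable \<pi> (\<lambda>v. (\<Sum>i<N. capped N r (v i)) / real N)"
      by (intro integrable_divide_zero Bochner_Integration.integrable_sum int) simp
    show "integrable \<pi> (\<lambda>v. \<Sum>i<N. spa_transfer N (reserve_dist N r) i v)"
      by (intro integrable_revenue[OF assms(1,2) \<pi>] prob_space_reserve_dist assms)
    show "AE v in \<pi>. (\<Sum>i<N. capped N r (v i)) / real N \<le> (\<Sum>i<N. spa_transfer N (reserve_dist N r) i v)"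
      using couplings_AE[OF assms(2) \<pi>]
    proof eventually_elim
      case (elim v)
      then show ?case
        using spa_revenue_random_ge[OF assms(1,3), of v]
        by (simp add: sum_spa_transfer prob_space_reserve_dist assms)
    qed
  qed
  finally show "L_fun N \<mu> r \<le> (\<integral>v. (\<Sum>i<N. spa_transfer N (reserve_dist N r) i v) \<partial>\<pi>)" .
qed

subsection \<open>The deterministic reserve\<close>

text \<open>The quantile of bidder \<open>i\<close> when \<open>j\<close> is the leader and \<open>u\<close> is the common uniform draw: above \<open>c\<close>, the
  interval \<open>(c, 1)\<close> is mapped affinely onto its top \<open>N\<close>-th part for the leader and onto the rest for
  the others.\<close>
definition regroup :: "nat \<Rightarrow> real \<Rightarrow> nat \<Rightarrow> nat \<times> real \<Rightarrow> real" where
  "regroup N c i = (\<lambda>(j, u). if u < c then u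
     else if i = j then 1 - 1 / real N + (1 / real N) * u
     else c / real N + ((real N - 1) / real N) * u)"

abbreviation leader_quantile :: "nat \<Rightarrow> (nat \<times> real) measure" where
  "leader_quantile N \<equiv> measure_pmf (pmf_of_set {..<N}) \<Otimes>\<^sub>M unit_uniform"

text \<open>With d = 1 - (1-c)/N, the leader's map carries (c,1) onto (d,1), and by
  \<open>regroup_low\<close> the other map carries it onto (c,d).\<close>

lemma regroup_high:
  assumes "2 \<le> N"
  shows "1 - (1 - c) / real N < 1 - 1 / real N + (1 / real N) * u \<longleftrightarrow> c < u"
    "1 - 1 / real N + (1 / real N) * u < 1 \<longleftrightarrow> u < 1"
  using assms by (auto simp: field_simps)

lemma regroup_low:
  assumes "2 \<le> N"
  shows "c < c / real N + ((real N - 1) / real N) * u \<longleftrightarrow> c < u"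
    "c / real N + ((real N - 1) / real N) * u < 1 - (1 - c) / real N \<longleftrightarrow> u < 1"
proof -
  define k where "k = real N - 1"
  have k: "0 < k" "real N = k + 1" using assms by (auto simp: k_def)
  have l: "c / real N + ((real N - 1) / real N) * u = (c + k * u) / (k + 1)"
    and d: "1 - (1 - c) / real N = (c + k) / (k + 1)"
    using k(1) unfolding k(2) by (simp add: add_divide_distrib, simp add: field_simps)
  show "c < c / real N + ((real N - 1) / real N) * u \<longleftrightarrow> c < u"
    using k(1) unfolding l by (simp add: pos_less_divide_eq algebra_simps)
  show "c / real N + ((real N - 1) / real N) * u < 1 - (1 - c) / real N \<longleftrightarrow> u < 1"
    using k(1) unfolding l d by (simp add: divide_less_cancel)
qed

lemma measurable_regroup:
  assumes "2 \<le> N" "0 \<le> c" "c \<le> 1"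
  shows "regroup N c i \<in> leader_quantile N \<rightarrow>\<^sub>M unit_uniform"
proof (rule measurable_restrict_space2)
  show "regroup N c i \<in> space (leader_quantile N) \<rightarrow> {0<..<1}"
  proof
    fix x assume "x \<in> space (leader_quantile N)"
    then obtain j u where x: "x = (j, u)" "0 < u" "u < 1"
      by (auto simp: space_pair_measure space_restrict_space)
    have "0 < 1 - 1 / real N + (1 / real N) * u"
      using x assms by (intro add_nonneg_pos) (auto simp: field_simps)
    moreover have "0 < c / real N + ((real N - 1) / real N) * u"
      using x assms by (intro add_nonneg_pos) auto
    moreover have "1 - 1 / real N + (1 / real N) * u < 1"
      using regroup_high(2)[OF assms(1)] x by simp
    moreover have "c / real N + ((real N - 1) / real N) * u < 1"
    proof -
      have "(1 - c) / real N \<ge> 0" using assms by simp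
      then show ?thesis using regroup_low(2)[OF assms(1), of c u] x by linarith
    qed
    ultimately show "regroup N c i x \<in> {0<..<1}"
      using x by (simp add: regroup_def)
  qed
  let ?M = "leader_quantile N"
  have fst: "fst \<in> ?M \<rightarrow>\<^sub>M count_space UNIV"
    using measurable_fst[of "measure_pmf (pmf_of_set {..<N})" unit_uniform]
    by (simp cong: measurable_cong_sets)
  have snd: "snd \<in> borel_measurable ?M"
    by (rule measurable_compose[OF measurable_snd]) (simp add: measurable_restrict_space1)
  have "{x \<in> space ?M. i = fst x} = fst -` {i} \<inter> space ?M" by auto
  then have "{x \<in> space ?M. i = fst x} \<in> sets ?M"
    using measurable_sets[OF fst, of "{i}"] by simp
  moreover have "{x \<in> space ?M. snd x < c} \<in> sets ?M"
    using snd by (intro borel_measurable_less) auto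
  ultimately have "regroup N c i \<in> borel_measurable ?M"
    unfolding regroup_def case_prod_beta
    by (intro measurable_If borel_measurable_add borel_measurable_times borel_measurable_const snd)
  then show "regroup N c i \<in> ?M \<rightarrow>\<^sub>M lborel" by simp
qed

lemma prob_space_leader_quantile: "prob_space (leader_quantile N)"
  by (intro prob_space_pair prob_space_unit_uniform) (simp add: measure_pmf.prob_space_axioms)

text \<open>Each regrouping pushes the uniform distribution forward to itself: the stretching factors
  \<open>N\<close> and \<open>N / (N - 1)\<close> cancel against the probabilities of the two roles.\<close>
lemma distr_regroup:
  assumes "2 \<le> N" "0 \<le> c" "c \<le> 1" "i < N"
  shows "distr (leader_quantile N) unit_uniform (regroup N c i) = unit_uniform"
proof (rule measure_eqI)
  interpret U: prob_space unit_uniform by (rule prob_space_unit_uniform)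
  note meas = measurable_regroup[OF assms(1-3), of i]
  fix A assume "A \<in> sets (distr (leader_quantile N) unit_uniform (regroup N c i))"
  then have AU: "A \<in> sets unit_uniform" by simp
  then have A [measurable]: "A \<in> sets borel" and A01: "A \<subseteq> {0<..<1}"
    by (auto simp: sets_restrict_space_iff)
  define d where "d = 1 - (1 - c) / real N"
  have cd: "c \<le> d" "d \<le> 1"
  proof -
    have "(1 - c) / real N \<le> (1 - c) / 1" using assms by (intro divide_left_mono) auto
    then show "c \<le> d" "d \<le> 1" using assms by (auto simp: d_def)
  qed
  let ?m = "\<lambda>B. measure lborel (A \<inter> B)"
  have em: "emeasure lborel (A \<inter> B) = ennreal (?m B)" if "B \<in> sets borel" for B
  proof (rule emeasure_eq_ennreal_measure)
    have "emeasure lborel (A \<inter> B) \<le> emeasure lborel {0<..<1::real}"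
      using A01 by (intro emeasure_mono) auto
    then show "emeasure lborel (A \<inter> B) \<noteq> top"
      by (auto simp: top_unique)
  qed
  let ?t = "\<lambda>u. 1 - 1 / real N + (1 / real N) * u" and ?l = "\<lambda>u. c / real N + ((real N - 1) / real N) * u"
  \<comment> \<open>Affine change of variables: the preimage of a set under a map of slope s has its
    measure divided by s.\<close>
  have stretch: "(\<integral>\<^sup>+u. indicator (A \<inter> B) (t + s * u) \<partial>lborel) = ennreal (?m B / s)"
    if "0 < s" "B \<in> sets borel" for s t B
  proof -
    note that(2) [measurable]
    have "ennreal (?m B) = ennreal s * (\<integral>\<^sup>+u. indicator (A \<inter> B) (t + s * u) \<partial>lborel)"
      using nn_integral_real_affine[of "indicator (A \<inter> B)" s t] that em[OF that(2)] by simp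
    then have "ennreal (1 / s) * ennreal (?m B) =
        ennreal (1 / s) * ennreal s * (\<integral>\<^sup>+u. indicator (A \<inter> B) (t + s * u) \<partial>lborel)"
      by (simp add: mult.assoc)
    also have "ennreal (1 / s) * ennreal s = 1"
      using that(1) by (simp flip: ennreal_mult)
    finally show ?thesis using that(1) by (simp flip: ennreal_mult)
  qed
  \<comment> \<open>The law of bidder i's quantile given leader j. Bidder i leads with probability
    1/N and follows with probability (N-1)/N, so averaging over j gives both upper pieces weight
    one.\<close>
  have K: "(\<integral>\<^sup>+u. indicator A (regroup N c i (j, u)) \<partial>unit_uniform) =
      ennreal (?m {..<c} + (if j = i then real N * ?m {d<..} else real N / (real N - 1) * ?m {c<..<d}))" for j
  proof -
    have "(\<integral>\<^sup>+u. indicator A (regroup N c i (j, u)) \<partial>unit_uniform)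
        = (\<integral>\<^sup>+u. indicator A (regroup N c i (j, u)) * indicator {0<..<1} u \<partial>lborel)"
      by (subst nn_integral_restrict_space) auto
    also have "\<dots> = (\<integral>\<^sup>+u. indicator (A \<inter> {..<c}) u +
        (if j = i then indicator (A \<inter> {d<..}) (?t u) else indicator (A \<inter> {c<..<d}) (?l u)) \<partial>lborel)"
    proof (rule nn_integral_cong_AE)
      show "AE u in lborel. indicator A (regroup N c i (j, u)) * indicator {0<..<1} u =
        (indicator (A \<inter> {..<c}) u +
        (if j = i then indicator (A \<inter> {d<..}) (?t u) else indicator (A \<inter> {c<..<d}) (?l u)) :: ennreal)"
        using AE_lborel_singleton[of c]
      proof eventually_elim
        case (elim u)
        consider "u < c" | "c < u" using elim by linarith
        then show ?case
        proof cases
          case 1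
          then show ?thesis
            using A01 assms(3) regroup_high(1)[OF assms(1), of c u] regroup_low(1)[OF assms(1), of c u]
            by (auto simp: regroup_def indicator_def d_def)
        next
          case 2
          then have "0 < u" using assms by simp
          have high: "?t u \<in> A \<Longrightarrow> u < 1"
            using A01 regroup_high(2)[OF assms(1), of u] by auto
          show ?thesis
          proof (cases "j = i")
            case True
            then show ?thesis using 2 \<open>0 < u\<close> high regroup_high(1)[OF assms(1), of c u]
              by (auto simp: regroup_def indicator_def d_def)
          next
            case False
            then show ?thesis using 2 \<open>0 < u\<close> regroup_low[OF assms(1), of c u]
              by (auto simp: regroup_def indicator_def d_def)
          qed
        qed
      qed
    qed
    also have "\<dots> = emeasure lborel (A \<inter> {..<c}) +
        (if j = i then (\<integral>\<^sup>+u. indicator (A \<inter> {d<..}) (?t u) \<partial>lborel)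
         else (\<integral>\<^sup>+u. indicator (A \<inter> {c<..<d}) (?l u) \<partial>lborel))"
      by (cases "j = i") (simp_all add: nn_integral_add)
    also have "\<dots> = ennreal (?m {..<c}) + ennreal (if j = i then real N * ?m {d<..} else real N / (real N - 1) * ?m {c<..<d})"
    proof -
      have "(\<integral>\<^sup>+u. indicator (A \<inter> {d<..}) (?t u) \<partial>lborel) = ennreal (real N * ?m {d<..})"
        using stretch[of "1 / real N" "{d<..}" "1 - 1 / real N"] assms(1) by (simp add: mult.commute)
      moreover have "(\<integral>\<^sup>+u. indicator (A \<inter> {c<..<d}) (?l u) \<partial>lborel) = ennreal (real N / (real N - 1) * ?m {c<..<d})"
        using stretch[of "(real N - 1) / real N" "{c<..<d}" "c / real N"] assms(1) by (simp add: mult.commute)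
      ultimately show ?thesis using em[of "{..<c}"] by simp
    qed
    finally show ?thesis using assms(1) by (simp add: ennreal_plus)
  qed
  have "emeasure (distr (leader_quantile N) unit_uniform (regroup N c i)) A
      = (\<integral>\<^sup>+x. indicator A (regroup N c i x) \<partial>leader_quantile N)"
    using AU nn_integral_distr[OF meas, of "indicator A"]
      nn_integral_indicator[of A "distr (leader_quantile N) unit_uniform (regroup N c i)"]
    by simp
  also have "\<dots> = (\<integral>\<^sup>+j. (\<integral>\<^sup>+u. indicator A (regroup N c i (j, u)) \<partial>unit_uniform) \<partial>measure_pmf (pmf_of_set {..<N}))"
    using measurable_compose[OF meas borel_measurable_indicator[OF AU]]
    by (subst U.nn_integral_fst[symmetric]) auto
  also have "\<dots> = (\<Sum>j<N. ennreal (?m {..<c} + (if j = i then real N * ?m {d<..} else real N / (real N - 1) * ?m {c<..<d}))) / real N"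
    unfolding K using assms(1) by (subst nn_integral_pmf_of_set) (auto simp: lessThan_empty_iff ennreal_of_nat_eq_real_of_nat)
  also have "\<dots> = ennreal ((\<Sum>j<N. ?m {..<c} + (if j = i then real N * ?m {d<..} else real N / (real N - 1) * ?m {c<..<d})) / real N)"
    using assms(1) by (subst sum_ennreal) (auto simp: divide_ennreal sum_nonneg)
  also have "(\<Sum>j<N. ?m {..<c} + (if j = i then real N * ?m {d<..} else real N / (real N - 1) * ?m {c<..<d}))
     = real N * (?m {..<c} + ?m {d<..} + ?m {c<..<d})"
  proof -
    have "(\<Sum>j<N. if j = i then real N * ?m {d<..} else real N / (real N - 1) * ?m {c<..<d})
      = real N * ?m {d<..} + (\<Sum>j\<in>{..<N} - {i}. real N / (real N - 1) * ?m {c<..<d})"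
      using assms(4) by (simp add: sum.remove[of _ i])
    also have "\<dots> = real N * ?m {d<..} + real N * ?m {c<..<d}"
      using assms(1,4) by (simp add: of_nat_diff)
    finally show ?thesis by (simp add: sum.distrib algebra_simps)
  qed
  also have "ennreal (real N * (?m {..<c} + ?m {d<..} + ?m {c<..<d}) / real N)
      = emeasure lborel (A \<inter> {..<c}) + emeasure lborel (A \<inter> {d<..}) + emeasure lborel (A \<inter> {c<..<d})"
    using assms(1) by (simp add: em ennreal_plus)
  also have "\<dots> = emeasure lborel (A \<inter> {..<c} \<union> A \<inter> {d<..} \<union> A \<inter> {c<..<d})"
  proof -
    have "emeasure lborel (A \<inter> {..<c}) + emeasure lborel (A \<inter> {d<..}) = emeasure lborel (A \<inter> {..<c} \<union> A \<inter> {d<..})"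
      using cd by (intro plus_emeasure) auto
    moreover have "emeasure lborel (A \<inter> {..<c} \<union> A \<inter> {d<..}) + emeasure lborel (A \<inter> {c<..<d})
        = emeasure lborel (A \<inter> {..<c} \<union> A \<inter> {d<..} \<union> A \<inter> {c<..<d})"
      using cd by (intro plus_emeasure) auto
    ultimately show ?thesis by simp
  qed
  also have "\<dots> = emeasure lborel A"
  proof (rule emeasure_eq_AE)
    show "AE u in lborel. u \<in> A \<inter> {..<c} \<union> A \<inter> {d<..} \<union> A \<inter> {c<..<d} \<longleftrightarrow> u \<in> A"
      using AE_lborel_singleton[of c] AE_lborel_singleton[of d]
      by eventually_elim auto
  qed auto
  also have "\<dots> = emeasure unit_uniform A"
    using A01 by (subst emeasure_restrict_space) auto
  finally show "emeasure (distr (leader_quantile N) unit_uniform (regroup N c i)) A = emeasure unit_uniform A" .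
qed simp

text \<open>Values are the pseudoinverse \<open>I\<close> of the cdf applied to regrouped quantiles.
  Since regrouping preserves the uniform law, every marginal is \<open>\<mu>\<close>; monotonicity
  of \<open>I\<close> turns the order of the quantile blocks into the order x \<le> z \<le> leader's
  value.\<close>

lemma leader_coupling:
  assumes "2 \<le> N" and \<mu>: "valid_marginal \<mu>" and p: "0 \<le> p" "p \<le> 1"
  shows "\<exists>(X :: nat \<Rightarrow> nat \<times> real \<Rightarrow> real) z. 0 \<le> z \<and> z \<le> 1 \<and>
    (\<forall>i<N. X i \<in> borel_measurable (leader_quantile N) \<and> distr (leader_quantile N) borel (X i) = \<mu>) \<and>
    (AE \<omega> in leader_quantile N. (\<forall>i<N. 0 \<le> X i \<omega>) \<and> ((\<forall>i<N. X i \<omega> < p) \<or>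
      (\<exists>j<N. z \<le> X j \<omega> \<and> (\<exists>x. p \<le> x \<and> x \<le> z \<and> (\<forall>i<N. i \<noteq> j \<longrightarrow> X i \<omega> = x)))))"
proof -
  interpret prob_space \<mu> using \<mu> by (simp add: valid_marginal_def)
  have sets: "sets \<mu> = sets borel" using \<mu> by (simp add: valid_marginal_def)
  interpret cdf_distribution \<mu>
    by (intro cdf_distribution.intro real_distribution.intro prob_space_axioms
        real_distribution_axioms.intro sets)
  interpret P: pair_sigma_finite "measure_pmf (pmf_of_set {..<N})" unit_uniform
    using prob_space_unit_uniform
    by (intro pair_sigma_finite.intro) (auto intro: prob_space_imp_sigma_finite measure_pmf.prob_space_axioms)
  \<comment> \<open>The mass strictly below p, because a bid equal to the reserve still
    wins.\<close>
  define c where "c = measure \<mu> {..<p}"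
  have c: "0 \<le> c" "c \<le> 1" by (auto simp: c_def)
  have unit: "measure \<mu> {0..1} = 1"
    using \<mu> by (simp add: valid_marginal_def measure_def)
  have C1: "C 1 = 1"
  proof -
    have "measure \<mu> {0..1} \<le> C 1"
      unfolding cdf_def by (intro finite_measure_mono) (auto simp: sets)
    then show ?thesis using unit cdf_bounded_prob[of 1] by simp
  qed
  have C0: "C x = 0" if "x < 0" for x
  proof -
    have "C x + measure \<mu> {0..1} = measure \<mu> ({..x} \<union> {0..1})"
      unfolding cdf_def using that by (intro finite_measure_Union[symmetric]) (auto simp: sets)
    also have "\<dots> \<le> 1" by simp
    finally show ?thesis using unit cdf_nonneg[of x] by simp
  qed
  have I_ge0: "0 \<le> I u" if "0 < u" "u < 1" for u
    using pseudoinverse[OF that, of "I u"] C0[of "I u"] that by (auto simp: not_less[symmetric])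
  have I_le1: "I u \<le> 1" if "0 < u" "u < 1" for u
    using pseudoinverse[OF that, of 1] C1 that by auto
  have I_mono: "I u \<le> I w" if "0 < u" "u \<le> w" "w < 1" for u w
    using mono_onD[OF mono_I, of u w] that by auto
  \<comment> \<open>If \<open>I u\<close> were at least p, the cdf would stay at or below u to the
    left of p, and so would its left limit c.\<close>
  have I_less: "I u < p" if "0 < u" "u < 1" "u < c" for u
  proof (rule ccontr)
    assume "\<not> I u < p"
    then have "C x \<le> u" if "x < p" for x
      using pseudoinverse[OF \<open>0 < u\<close> \<open>u < 1\<close>, of x] that by auto
    then have "eventually (\<lambda>x. C x \<le> u) (at_left p)"
      by (auto simp: eventually_at_filter)
    then have "c \<le> u"
      unfolding c_def by (intro tendsto_upperbound[OF cdf_at_left]) auto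
    then show False using that by simp
  qed
  have I_ge: "p \<le> I u" if "0 < u" "u < 1" "c < u" for u
  proof (rule ccontr)
    assume "\<not> p \<le> I u"
    then have "C (I u) \<le> c"
      unfolding cdf_def c_def by (intro finite_measure_mono) (auto simp: sets)
    then show False using pseudoinverse[OF that(1,2), of "I u"] that by simp
  qed
  define d where "d = 1 - (1 - c) / real N"
  \<comment> \<open>The quantile at the lower end of the leader's block. If c = 1 then d = 1 is
    outside the domain of \<open>I\<close>; sales then have probability zero and 1 serves as a
    placeholder.\<close>
  define z where "z = (if c < 1 then I d else 1)"
  have d: "0 < d" "d < 1" if "c < 1"
    using that c assms(1) by (auto simp: d_def field_simps add_pos_nonneg)
  define X where "X i \<omega> = I (regroup N c i \<omega>)" for i \<omega>
  note rg = measurable_regroup[OF assms(1) c]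
  have mI: "I \<in> borel_measurable unit_uniform"
    using measurable_CI by (simp cong: measurable_cong_sets add: sets_restrict_space)
  have X: "X i \<in> borel_measurable (leader_quantile N)" for i
    unfolding X_def by (rule measurable_compose[OF rg mI])
  have "distr (leader_quantile N) borel (X i) = \<mu>" if "i < N" for i
  proof -
    have "distr (leader_quantile N) borel (X i) = distr (distr (leader_quantile N) unit_uniform (regroup N c i)) borel I"
      unfolding X_def using distr_distr[OF mI rg] by (simp add: comp_def)
    then show ?thesis
      using distr_regroup[OF assms(1) c that] distr_I_eq_M by simp
  qed
  moreover have "AE \<omega> in leader_quantile N. (\<forall>i<N. 0 \<le> X i \<omega>) \<and> ((\<forall>i<N. X i \<omega> < p) \<or>
      (\<exists>j<N. z \<le> X j \<omega> \<and> (\<exists>x. p \<le> x \<and> x \<le> z \<and> (\<forall>i<N. i \<noteq> j \<longrightarrow> X i \<omega> = x))))"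
  proof -
    \<comment> \<open>\<open>I_less\<close> and \<open>I_ge\<close> leave the quantile c undecided,
      so this null set is discarded.\<close>
    have "AE u in unit_uniform. u \<noteq> c"
      using AE_lborel_singleton[of c] by (subst AE_restrict_space_iff) auto
    then have ne: "AE \<omega> in leader_quantile N. snd \<omega> \<noteq> c"
    proof (intro P.AE_pair_measure)
      have "{c} \<inter> {0<..<1} \<in> sets unit_uniform" by (simp add: sets_restrict_space_iff)
      then have "space (leader_quantile N) - (snd -` ({c} \<inter> {0<..<1}) \<inter> space (leader_quantile N)) \<in> sets (leader_quantile N)"
        by (intro sets.compl_sets measurable_sets[OF measurable_snd])
      moreover have "space (leader_quantile N) - (snd -` ({c} \<inter> {0<..<1}) \<inter> space (leader_quantile N))
          = {\<omega> \<in> space (leader_quantile N). snd \<omega> \<noteq> c}"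
        by (auto simp: space_pair_measure space_restrict_space)
      ultimately show "{\<omega> \<in> space (leader_quantile N). snd \<omega> \<noteq> c} \<in> sets (leader_quantile N)"
        by simp
    qed simp
    have "AE j in measure_pmf (pmf_of_set {..<N}). j < N"
      using assms(1) by (subst AE_measure_pmf_iff) (auto simp: lessThan_empty_iff)
    then have "AE j in distr (leader_quantile N) (measure_pmf (pmf_of_set {..<N})) fst. j < N"
      by (subst prob_space.distr_pair_fst[OF prob_space_unit_uniform])
    then have j: "AE \<omega> in leader_quantile N. fst \<omega> < N"
      by (rule AE_distrD[OF measurable_fst])
    show ?thesis using ne j AE_space
    proof eventually_elim
      case (elim \<omega>)
      obtain j u where \<omega>: "\<omega> = (j, u)" by (cases \<omega>)
      with elim have u: "0 < u" "u < 1" "u \<noteq> c" "j < N"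
        by (auto simp: space_pair_measure space_restrict_space)
      have rg01: "0 < regroup N c i \<omega>" "regroup N c i \<omega> < 1" for i
        using measurable_space[OF rg elim(3), of i] by (auto simp: space_restrict_space)
      have nonneg: "0 \<le> X i \<omega>" for i
        unfolding X_def by (rule I_ge0[OF rg01])
      show ?case
      proof (cases "u < c")
        case True
        then have "X i \<omega> < p" for i
          using u I_less by (simp add: X_def \<omega> regroup_def)
        then show ?thesis using nonneg by blast
      next
        case False
        then have cu: "c < u" "c < 1" using u by auto
        define x where "x = I (c / real N + ((real N - 1) / real N) * u)"
        have X_eq: "X i \<omega> = x" if "i \<noteq> j" for i
          using that cu by (simp add: X_def x_def \<omega> regroup_def)
        \<comment> \<open>Some index other than the leader, used to read off that the followers'
          quantile lies in (0,1).\<close>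
        define i where "i = (if j = 0 then 1 else 0 :: nat)"
        have i: "i \<noteq> j" by (simp add: i_def)
        have low: "0 < c / real N + ((real N - 1) / real N) * u" "c / real N + ((real N - 1) / real N) * u < 1"
          using rg01[of i] i cu by (simp_all add: \<omega> regroup_def)
        have high: "0 < 1 - 1 / real N + (1 / real N) * u" "1 - 1 / real N + (1 / real N) * u < 1"
          using rg01[of j] cu by (simp_all add: \<omega> regroup_def)
        have "d \<le> 1 - 1 / real N + (1 / real N) * u"
          using regroup_high(1)[OF assms(1), of c u] cu by (simp add: d_def)
        then have "z \<le> X j \<omega>"
          using I_mono[OF d(1)] cu high by (simp add: z_def X_def \<omega> regroup_def)
        moreover have "x \<le> z"
          using I_mono[OF low(1)] d cu u regroup_low(2)[OF assms(1), of c u]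
          by (simp add: z_def x_def d_def)
        moreover have "p \<le> x"
          unfolding x_def using I_ge[OF low] regroup_low(1)[OF assms(1), of c u] cu by simp
        ultimately show ?thesis using X_eq nonneg u(4) by blast
      qed
    qed
  qed
  moreover have "0 \<le> z" "z \<le> 1"
    using I_ge0[OF d] I_le1[OF d] by (auto simp: z_def)
  ultimately show ?thesis using X by (intro exI[of _ X] exI[of _ z]) simp
qed

section \<open>Pointwise comparison of revenue with the capped average\<close>

lemma spa_revenue_leader:
  assumes "2 \<le> N" "j < N" "z \<le> v j" "p \<le> x" "x \<le> z" "\<And>i. i < N \<Longrightarrow> i \<noteq> j \<Longrightarrow> v i = x"
  shows "spa_revenue N p v = x"
proof -
  have "(if j = 0 then 1 else 0) \<in> {..<N} - {j}" using assms(1,2) by auto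
  then have "v ` ({..<N} - {j}) = {x}" using assms(6) by force
  moreover have "v i \<le> v j" if "i < N" for i
    using assms(3,5) assms(6)[of i] that by (cases "i = j") auto
  ultimately show ?thesis
    using spa_revenue_eq[of j N v p] assms by simp
qed

lemma spa_revenue_below_reserve:
  assumes "2 \<le> N" "\<And>i. i < N \<Longrightarrow> 0 \<le> v i" "\<And>i. i < N \<Longrightarrow> v i < p"
  shows "spa_revenue N p v = 0"
  using spa_maximizer[of N v, OF assms(1,2)] assms(3) by force

text \<open>The leader reaches the cap and contributes exactly z; the rest is the tangent
  inequality, with equality at x = z.\<close>

lemma sum_capped_leader:
  assumes "2 \<le> N" "j < N" "0 < z" "z \<le> v j" "0 \<le> x" "x \<le> z" "\<And>i. i < N \<Longrightarrow> i \<noteq> j \<Longrightarrow> v i = x"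
  shows "x \<le> (\<Sum>i<N. capped N z (v i)) / real N"
    "x < z \<Longrightarrow> x < (\<Sum>i<N. capped N z (v i)) / real N"
proof -
  have "(\<Sum>i<N. capped N z (v i)) = capped N z (v j) + (\<Sum>i\<in>{..<N} - {j}. capped N z (v i))"
    using assms(2) by (simp add: sum.remove)
  also have "\<dots> = z + (real N - 1) * capped N z x"
    using assms(1-4,7) by (simp add: capped_above of_nat_diff)
  finally have sum: "(\<Sum>i<N. capped N z (v i)) = z + (real N - 1) * capped N z x" .
  have "capped N z z = z" using assms by (simp add: capped_above)
  then have "x = z \<Longrightarrow> z + (real N - 1) * capped N z x = real N * x"
    by (simp add: algebra_simps)
  then show "x \<le> (\<Sum>i<N. capped N z (v i)) / real N"
    "x < z \<Longrightarrow> x < (\<Sum>i<N. capped N z (v i)) / real N"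
    using capped_tangent[of N z x] assms(1,3,5,6) unfolding sum
    by (cases "x = z"; simp add: field_simps)+
qed

text \<open>The case \<open>z = 0\<close> occurs if \<open>p = 0\<close> and \<open>F\<close> has an atom of mass at least \<open>1 - 1/N\<close> at \<open>0\<close>; then
  the revenue vanishes and any positive parameter works.\<close>
lemma leader_profile_bound:
  assumes "2 \<le> N" "0 \<le> z" and v0: "\<And>i. i < N \<Longrightarrow> 0 \<le> v i"
    and v: "(\<forall>i<N. v i < p) \<or>
      (\<exists>j<N. z \<le> v j \<and> (\<exists>x. p \<le> x \<and> x \<le> z \<and> (\<forall>i<N. i \<noteq> j \<longrightarrow> v i = x)))"
    and p: "0 \<le> p"
  defines "w \<equiv> if z = 0 then 1 else z"
  shows "spa_revenue N p v \<le> (\<Sum>i<N. capped N w (v i)) / real N"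
    "0 < v 0 \<Longrightarrow> v 0 < w \<Longrightarrow> spa_revenue N p v < (\<Sum>i<N. capped N w (v i)) / real N"
proof -
  have w: "0 < w" using assms(2) by (simp add: w_def)
  note nonneg = capped_bounds(1)[OF assms(1) w]
  have pos: "0 < (\<Sum>i<N. capped N w (v i)) / real N" if "0 < v 0"
    using capped_pos[OF assms(1) w that] assms(1) nonneg
    by (intro divide_pos_pos sum_pos2[where i=0]) auto
  have sum_nonneg: "0 \<le> (\<Sum>i<N. capped N w (v i)) / real N"
    using nonneg by (intro divide_nonneg_nonneg sum_nonneg) auto
  have "spa_revenue N p v = 0 \<or> 0 < z \<and> (\<exists>j x. j < N \<and> z \<le> v j \<and> p \<le> x \<and> x \<le> z \<and>
      (\<forall>i<N. i \<noteq> j \<longrightarrow> v i = x))"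
    using v
  proof (elim disjE exE conjE)
    assume "\<forall>i<N. v i < p"
    then show ?thesis using spa_revenue_below_reserve[of N v p] assms(1) v0 by simp
  next
    fix j x assume *: "j < N" "z \<le> v j" "p \<le> x" "x \<le> z" "\<forall>i<N. i \<noteq> j \<longrightarrow> v i = x"
    show ?thesis
    proof (cases "z = 0")
      case True
      then have "x = 0" using * p by simp
      then show ?thesis using spa_revenue_leader[of N j z v p x] assms(1) * by simp
    next
      case False
      then show ?thesis using assms(2) * by auto
    qed
  qed
  then consider "spa_revenue N p v = 0"
    | j x where "0 < z" "j < N" "z \<le> v j" "p \<le> x" "x \<le> z" "\<forall>i<N. i \<noteq> j \<longrightarrow> v i = x"
    by blast
  then have "spa_revenue N p v \<le> (\<Sum>i<N. capped N w (v i)) / real N \<and>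
    (0 < v 0 \<longrightarrow> v 0 < w \<longrightarrow> spa_revenue N p v < (\<Sum>i<N. capped N w (v i)) / real N)"
  proof cases
    case 1
    then show ?thesis using pos sum_nonneg by auto
  next
    case 2
    have "w = z" using 2(1) by (simp add: w_def)
    have rev: "spa_revenue N p v = x"
      using spa_revenue_leader[of N j z v p x] assms(1) 2 by simp
    \<comment> \<open>Bidder 0 cannot be the leader when its value is below z, so its value is the
      common x.\<close>
    have "x < z" if "v 0 < z"
      using 2(2,3,6) that assms(1) by (cases "j = 0") auto
    then show ?thesis
      using sum_capped_leader[of N j z v x] assms(1) p 2 unfolding rev \<open>w = z\<close> by auto
  qed
  then show "spa_revenue N p v \<le> (\<Sum>i<N. capped N w (v i)) / real N"
    "0 < v 0 \<Longrightarrow> v 0 < w \<Longrightarrow> spa_revenue N p v < (\<Sum>i<N. capped N w (v i)) / real N"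
    by auto
qed

text \<open>A single coupling suffices, since its revenue bounds the infimum from above. The
  parameter w is the quantile z of that coupling, replaced by 1 if z = 0.\<close>

lemma spa_rg_det_less:
  assumes "2 \<le> N" and \<mu>: "valid_marginal \<mu>" and p: "0 \<le> p" "p \<le> 1"
  shows "\<exists>w\<in>{0<..1}. spa_rg N \<mu> (det_reserve p) < L_fun N \<mu> w"
proof -
  let ?M = "leader_quantile N" and ?G = "det_reserve p"
  let ?R = "\<lambda>v. \<Sum>i<N. spa_transfer N ?G i v"
  interpret M: prob_space ?M by (rule prob_space_leader_quantile)
  have sets: "sets \<mu> = sets borel" using \<mu> by (simp add: valid_marginal_def)
  have G: "prob_space ?G" "sets ?G = sets borel"
    by (simp_all add: det_reserve_def prob_space_return)
  obtain X z where z: "0 \<le> z" "z \<le> 1"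
    and X: "\<And>i. i < N \<Longrightarrow> X i \<in> borel_measurable ?M"
    and distr: "\<And>i. i < N \<Longrightarrow> distr ?M borel (X i) = \<mu>"
    and AE: "AE \<omega> in ?M. (\<forall>i<N. 0 \<le> X i \<omega>) \<and> ((\<forall>i<N. X i \<omega> < p) \<or>
      (\<exists>j<N. z \<le> X j \<omega> \<and> (\<exists>x. p \<le> x \<and> x \<le> z \<and> (\<forall>i<N. i \<noteq> j \<longrightarrow> X i \<omega> = x))))"
  proof -
    obtain X z where *: "0 \<le> z" "z \<le> 1"
      "\<forall>i<N. X i \<in> borel_measurable ?M \<and> distr ?M borel (X i) = \<mu>"
      "AE \<omega> in ?M. (\<forall>i<N. 0 \<le> X i \<omega>) \<and> ((\<forall>i<N. X i \<omega> < p) \<or>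
        (\<exists>j<N. z \<le> X j \<omega> \<and> (\<exists>x. p \<le> x \<and> x \<le> z \<and> (\<forall>i<N. i \<noteq> j \<longrightarrow> X i \<omega> = x))))"
      using leader_coupling[OF assms] by (elim exE conjE)
    show thesis by (rule that[OF *(1,2) _ _ *(4)]) (simp_all add: *(3))
  qed
  define w where "w = (if z = 0 then 1 else z)"
  have w: "0 < w" "w \<le> 1" using z by (auto simp: w_def)
  let ?P = "PiM {..<N} (\<lambda>_. borel :: real measure)"
  define V where "V \<omega> = (\<lambda>i\<in>{..<N}. X i \<omega>)" for \<omega>
  define \<pi> where "\<pi> = distr ?M ?P V"
  have V: "V \<in> ?M \<rightarrow>\<^sub>M ?P"
    unfolding V_def using X by (intro measurable_restrict) auto
  have \<pi>: "\<pi> \<in> couplings N \<mu>"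
    unfolding \<pi>_def V_def using assms(1)
    by (intro couplingsI X distr M.prob_space_axioms) auto
  have int_R: "integrable ?M (\<lambda>\<omega>. ?R (V \<omega>))"
    using integrable_distr[OF V] integrable_revenue(1)[OF assms(1) \<mu> \<pi> G] by (simp add: \<pi>_def)
  have meas_h: "(\<lambda>\<omega>. capped N w (X i \<omega>)) \<in> borel_measurable ?M" if "i < N" for i
    by (rule measurable_compose[OF X[OF that] measurable_capped[OF assms(1)]])
  have int_h: "integrable ?M (\<lambda>\<omega>. capped N w (X i \<omega>))" if "i < N" for i
    using capped_bounds[OF assms(1) w(1)] meas_h[OF that] by (intro M.integrable_const_bound[where B=w]) auto
  have R_eq: "?R (V \<omega>) = spa_revenue N p (V \<omega>)" if "\<omega> \<in> space ?M" for \<omega>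
  proof -
    have "V \<omega> \<in> space ?P" using measurable_space[OF V that] .
    then have "(\<lambda>\<rho>. spa_revenue N \<rho> (V \<omega>)) \<in> borel_measurable borel"
      using measurable_Pair2[OF measurable_spa_revenue[of N]] by simp
    then show ?thesis
      unfolding sum_spa_transfer[OF G] unfolding det_reserve_def by (subst integral_return) auto
  qed
  have "spa_rg N \<mu> ?G \<le> (\<integral>v. ?R v \<partial>\<pi>)"
    unfolding spa_rg_def revenue_guarantee_def
    using \<pi> integrable_revenue(2)[OF assms(1) \<mu> _ G]
    by (intro cINF_lower bdd_belowI2[where m=0] integral_nonneg_AE) auto
  also have "\<dots> = (\<integral>\<omega>. ?R (V \<omega>) \<partial>?M)"
  proof -
    have "?R \<in> borel_measurable ?P"
      using borel_measurable_integrable[OF integrable_revenue(1)[OF assms(1) \<mu> \<pi> G]]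
      by (simp add: \<pi>_def)
    then show ?thesis unfolding \<pi>_def by (rule integral_distr[OF V])
  qed
  also have "\<dots> < (\<integral>\<omega>. (\<Sum>i<N. capped N w (X i \<omega>)) / real N \<partial>?M)"
  proof (rule M.integral_less_AE[OF int_R, where A="X 0 -` {0<..<w} \<inter> space ?M"])
    have X0: "X 0 \<in> borel_measurable ?M" "distr ?M borel (X 0) = \<mu>"
      using X distr assms(1) by auto
    \<comment> \<open>Full support makes the event of strict inequality non-null: the open interval
      (0,w) meets [0,1].\<close>
    have "emeasure \<mu> {0<..<w} > 0"
    proof -
      have "w / 2 \<in> {0<..<w} \<inter> {0..1}" using w by simp
      then have "{0<..<w} \<inter> {0..1} \<noteq> {}" by blast
      then show ?thesis using \<mu> open_greaterThanLessThan unfolding valid_marginal_def by blast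
    qed
    also have "emeasure \<mu> {0<..<w} = emeasure ?M (X 0 -` {0<..<w} \<inter> space ?M)"
      using emeasure_distr[OF X0(1), of "{0<..<w}"] X0(2) by simp
    finally show "emeasure ?M (X 0 -` {0<..<w} \<inter> space ?M) \<noteq> 0" by simp
    show "X 0 -` {0<..<w} \<inter> space ?M \<in> sets ?M"
      using X0(1) by (rule measurable_sets) simp
    show "integrable ?M (\<lambda>\<omega>. (\<Sum>i<N. capped N w (X i \<omega>)) / real N)"
      by (intro integrable_divide_zero Bochner_Integration.integrable_sum int_h) simp
    have bound: "AE \<omega> in ?M. ?R (V \<omega>) \<le> (\<Sum>i<N. capped N w (X i \<omega>)) / real N \<and>
      (0 < X 0 \<omega> \<longrightarrow> X 0 \<omega> < w \<longrightarrow> ?R (V \<omega>) < (\<Sum>i<N. capped N w (X i \<omega>)) / real N)"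
      using AE AE_space
    proof eventually_elim
      case (elim \<omega>)
      have V_eq: "V \<omega> i = X i \<omega>" if "i < N" for i using that by (simp add: V_def)
      have "(\<Sum>i<N. capped N w (V \<omega> i)) = (\<Sum>i<N. capped N w (X i \<omega>))"
        by (simp add: V_eq)
      moreover have "(\<forall>i<N. V \<omega> i < p) \<or>
          (\<exists>j<N. z \<le> V \<omega> j \<and> (\<exists>x. p \<le> x \<and> x \<le> z \<and> (\<forall>i<N. i \<noteq> j \<longrightarrow> V \<omega> i = x)))"
        using elim(1) by (simp add: V_eq cong: conj_cong)
      moreover have "0 \<le> V \<omega> i" if "i < N" for i
        using elim(1) that by (simp add: V_eq)
      ultimately show ?case
        using leader_profile_bound[of N z "V \<omega>" p] assms(1) z p R_eq[OF elim(2)] V_eq[of 0]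
        by (simp add: w_def[symmetric])
    qed
    show "AE \<omega> in ?M. ?R (V \<omega>) \<le> (\<Sum>i<N. capped N w (X i \<omega>)) / real N"
      using bound by eventually_elim simp
    show "AE \<omega> in ?M. \<omega> \<in> X 0 -` {0<..<w} \<inter> space ?M \<longrightarrow>
        ?R (V \<omega>) \<noteq> (\<Sum>i<N. capped N w (X i \<omega>)) / real N"
      using bound by eventually_elim auto
  qed
  also have "\<dots> = (\<Sum>i<N. \<integral>\<omega>. capped N w (X i \<omega>) \<partial>?M) / real N"
    using int_h by simp
  also have "\<dots> = L_fun N \<mu> w"
  proof -
    have "(\<integral>\<omega>. capped N w (X i \<omega>) \<partial>?M) = L_fun N \<mu> w" if "i < N" for i
      using integral_distr[OF X[OF that] measurable_capped[OF assms(1), of w]] distr[OF that]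
        L_fun_eq[OF assms(1) \<mu> w(1)] by simp
    then show ?thesis using assms(1) by simp
  qed
  finally show ?thesis using w by auto
qed

section \<open>Combining the two bounds through the maximality of \<open>rstar\<close>\<close>

theorem theorem4:
  fixes N :: nat and \<mu> :: "real measure" and rstar r0 :: real
  assumes "N \<ge> 2"
    and "valid_marginal \<mu>"
    and "rstar \<in> {0<..1}"
    and "\<forall>r\<in>{0<..1}. L_fun N \<mu> r \<le> L_fun N \<mu> rstar"
    and "r0 \<in> {0..1}"
    and "\<forall>r\<in>{0..1}. spa_rg N \<mu> (det_reserve r) \<le> spa_rg N \<mu> (det_reserve r0)"
  shows "spa_rg N \<mu> (reserve_dist N rstar) > spa_rg N \<mu> (det_reserve r0)"
proof -
  obtain w where "w \<in> {0<..1}" "spa_rg N \<mu> (det_reserve r0) < L_fun N \<mu> w"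
    using spa_rg_det_less[of N \<mu> r0] assms by auto
  moreover have "L_fun N \<mu> rstar \<le> spa_rg N \<mu> (reserve_dist N rstar)"
    using spa_rg_random_ge[of N \<mu> rstar] assms by simp
  ultimately show ?thesis using assms(4) by fastforce
qed

end
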